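(* Let $s_n=\sum_{k=0}^n\binom{n}{k}^2\binom{2k}{n}^2$ for $n\ge 0$, and let $(B_n^{(8)})_{n\ge 0}$ be the sequence of rational numbers with $B_0^{(8)}=0$, $B_1^{(8)}=1$ and $$(n+1)^3B^{(8)}_{n+1}=(2n+1)(12n^2+12n+4)B^{(8)}_n-16n^3B^{(8)}_{n-1}\qquad(n\ge 1).$$ Then $$\lim_{n\to\infty}\frac{B_n^{(8)}}{s_n}=\frac{7}{32}\zeta(3).$$
   Context: $\zeta$ is the Riemann zeta function. *)

theory Defs
  imports "HOL-Complex_Analysis.Complex_Analysis"
begin

definition dirichlet_zeta :: "complex \<Rightarrow> complex" where
  "dirichlet_zeta s = (\<Sum>n. 1 / of_nat (Suc n) powr s)"

(* The Dirichlet series on Re s > 1, and elsewhere its unique holomorphic extension to the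
   complex plane minus the point 1.  At the pole s = 1 the value is left unspecified. *)
definition riemann_zeta :: "complex \<Rightarrow> complex" where
  "riemann_zeta s =
     (if Re s > 1 then dirichlet_zeta s
      else (THE w. \<exists>f. f holomorphic_on (- {1}) \<and>
                       (\<forall>z. Re z > 1 \<longrightarrow> f z = dirichlet_zeta z) \<and> w = f s))"

definition s_seq :: "nat \<Rightarrow> nat" where
  "s_seq n = (\<Sum>k=0..n. (n choose k)^2 * ((2 * k) choose n)^2)"

end

theory Submission
  imports Defs "HOL-Real_Asymp.Real_Asymp"
begin

text \<open>
  Put \<open>kernel n t = ((2t) (2t+1) \<dots> (2t+n-1) / (t (t+1) \<dots> (t+n)))\<^sup>2\<close>. The coefficient of \<open>1 / (t+k)\<^sup>2\<close> in its partial
  fraction expansion is the \<open>k\<close>-th term of \<open>s_seq n\<close>, so the same creative telescoping certificate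
  shows that \<open>s_seq\<close> and \<open>remainder n = - (\<Sum>m. kernel' n (m + 1/2))\<close>, where \<open>kernel'\<close> is the derivative in \<open>t\<close>,
  satisfy the recurrence; summing over half-integers kills the boundary term, which has a double
  zero at \<open>t = 1/2\<close>. A solution is determined by its first two values, and \<open>remainder 0 = 14 \<zeta>(3)\<close>,
  \<open>remainder 1 = 56 \<zeta>(3) - 64\<close>, so \<open>remainder n = 14 \<zeta>(3) s_seq n - 64 B n\<close>. Finally \<open>remainder n\<close> is
  \<open>O(n 4\<^sup>n)\<close> whereas \<open>s_seq n \<ge> (2n choose n)\<^sup>2\<close> grows at least like \<open>16\<^sup>n / n\<^sup>2\<close>.
\<close>

section \<open>The kernel and its derivative\<close>

text \<open>Recursion in \<open>n\<close> instead of a quotient of products lets derivative, bounds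
  and shift be proved by induction.\<close>

fun kernel :: "nat \<Rightarrow> real \<Rightarrow> real" where
  "kernel 0 t = 1 / t^2"
| "kernel (Suc n) t = kernel n t * ((2 * t + n) / (t + n + 1))^2"

text \<open>Product rule; \<open>(n + 2) / (t + n + 1)^2\<close> is the derivative of
  \<open>(2 * t + n) / (t + n + 1)\<close>.\<close>

fun kernel' :: "nat \<Rightarrow> real \<Rightarrow> real" where
  "kernel' 0 t = - 2 / t^3"
| "kernel' (Suc n) t = kernel' n t * ((2 * t + n) / (t + n + 1))^2
     + kernel n t * (2 * ((2 * t + n) / (t + n + 1)) * ((real n + 2) / (t + n + 1)^2))"

section \<open>The three-term recurrence\<close>

text \<open>This is the recurrence for \<open>B\<close> with \<open>n + 1\<close> in place of
  \<open>n\<close>, so it ranges over all natural numbers.\<close>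

definition apery_rec :: "(nat \<Rightarrow> real) \<Rightarrow> bool" where
  "apery_rec u \<longleftrightarrow> (\<forall>n. (real n + 2)^3 * u (n + 2)
     = (2 * real n + 3) * (12 * (real n + 1)^2 + 12 * (real n + 1) + 4) * u (n + 1)
       - 16 * (real n + 1)^3 * u n)"

text \<open>The leading coefficient \<open>(n + 2)^3\<close> never vanishes, so each value is
  determined by the two before it.\<close>

lemma apery_rec_unique:
  assumes u: "apery_rec u" and v: "apery_rec v" and "u 0 = v 0" "u 1 = v 1"
  shows "u n = v n"
proof (induction n rule: less_induct)
  case (less n)
  show ?case
  proof (cases "n < 2")
    case True
    then have "n = 0 \<or> n = 1" by auto
    then show ?thesis using assms by auto
  next
    case False
    then obtain m where m: "n = m + 2" by (metis add.commute le_Suc_ex not_less)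
    have "u m = v m" "u (m + 1) = v (m + 1)" using less m by auto
    then have "(real m + 2)^3 * u (m + 2) = (real m + 2)^3 * v (m + 2)"
      using u v unfolding apery_rec_def by metis
    moreover have "(real m + 2)^3 \<noteq> 0" by simp
    ultimately show ?thesis using m by simp
  qed
qed

lemma apery_rec_lincomb:
  assumes "apery_rec u" "apery_rec v"
  shows "apery_rec (\<lambda>n. c * u n + d * v n)"
  unfolding apery_rec_def
proof
  fix n
  let ?p = "(2 * real n + 3) * (12 * (real n + 1)^2 + 12 * (real n + 1) + 4)"
    and ?q = "16 * (real n + 1)^3" and ?l = "(real n + 2)^3"
  have u: "?l * u (n + 2) = ?p * u (n + 1) - ?q * u n"
    and v: "?l * v (n + 2) = ?p * v (n + 1) - ?q * v n"
    using assms unfolding apery_rec_def by blast+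
  have "?l * (c * u (n + 2) + d * v (n + 2)) = c * (?l * u (n + 2)) + d * (?l * v (n + 2))"
    by algebra
  also have "\<dots> = ?p * (c * u (n + 1) + d * v (n + 1)) - ?q * (c * u n + d * v n)"
    unfolding u v by algebra
  finally show "?l * (c * u (n + 2) + d * v (n + 2))
    = ?p * (c * u (n + 1) + d * v (n + 1)) - ?q * (c * u n + d * v n)" .
qed

section \<open>Recurrence and growth of \<open>s_seq\<close>\<close>

definition term_root :: "nat \<Rightarrow> nat \<Rightarrow> real" where
  "term_root n k = real (n choose k) * real (2 * k choose n)"

text \<open>The extra terms vanish because \<open>n choose k\<close> does for \<open>k > n\<close>.
  A common range lets the sums for \<open>n\<close>, \<open>n + 1\<close> and \<open>n + 2\<close>
  be combined termwise.\<close>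

lemma s_seq_eq_sum:
  assumes "n \<le> N"
  shows "real (s_seq n) = (\<Sum>k\<le>N. (term_root n k)^2)"
proof -
  have "real (s_seq n) = (\<Sum>k=0..n. (term_root n k)^2)"
    unfolding s_seq_def term_root_def by (simp add: power_mult_distrib)
  also have "\<dots> = (\<Sum>k\<le>N. (term_root n k)^2)"
    by (rule sum.mono_neutral_left) (use assms in \<open>auto simp: term_root_def\<close>)
  finally show ?thesis .
qed

text \<open>Vanishing at negative integers makes the recurrence below hold without side conditions.\<close>

definition inv_fact :: "int \<Rightarrow> real" where
  "inv_fact z = (if z < 0 then 0 else 1 / fact (nat z))"

text \<open>At \<open>z = 0\<close> the factor \<open>z\<close> supplies the zero; for negative
  \<open>z\<close> both sides vanish by convention.\<close>

lemma inv_fact_minus_one: "inv_fact (z - 1) = of_int z * inv_fact z"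
proof (cases "z \<ge> 1")
  case True
  then obtain n where n: "z = int (Suc n)"
    by (metis Suc_pred' int_one_le_iff_zero_less zero_less_imp_eq_int)
  have "nat z = Suc n" "nat (z - 1) = n" using n by auto
  then show ?thesis using n unfolding inv_fact_def by simp
next
  case False
  then show ?thesis unfolding inv_fact_def by (cases "z = 0") auto
qed

text \<open>The two factors \<open>n!\<close> of the binomial coefficients cancel.\<close>

lemma term_root_eq:
  "term_root n k = fact (2 * k) / fact k * inv_fact (int n - int k) * inv_fact (2 * int k - int n)"
proof (cases "k \<le> n \<and> n \<le> 2 * k")
  case True
  then have a: "nat (int n - int k) = n - k" "nat (2 * int k - int n) = 2 * k - n" by auto
  show ?thesis using True unfolding term_root_def inv_fact_def a
    by (simp add: binomial_fact)
next
  case False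
  then show ?thesis unfolding term_root_def inv_fact_def by auto
qed

text \<open>The common factor \<open>c\<close> avoids the quotients of neighbouring terms, which are undefined at the ends of
  the summation range.\<close>

lemma term_root_common:
  obtains c where
    "term_root n k = c * (real n + 2 - real k) * (real n + 1 - real k)"
    "term_root (n + 1) k = c * (real n + 2 - real k) * (2 * real k - real n)"
    "term_root (n + 2) k = c * (2 * real k - real n) * (2 * real k - real n - 1)"
    "term_root (n + 2) (k + 1) = 2 * c * (2 * real k + 1) * (real n + 2 - real k)"
proof -
  \<comment> \<open>Both arguments of \<open>inv_fact\<close> are the largest that occur in the four
    terms, so the rest follows by lowering them with \<open>inv_fact_minus_one\<close>.\<close>
  define c where "c = fact (2 * k) / fact k * inv_fact (int n + 2 - int k) * inv_fact (2 * int k - int n)"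
  have a: "inv_fact (int n + 1 - int k) = (real n + 2 - real k) * inv_fact (int n + 2 - int k)"
    using inv_fact_minus_one[of "int n + 2 - int k"] by (simp add: algebra_simps)
  have b: "inv_fact (int n - int k) = (real n + 1 - real k) * inv_fact (int n + 1 - int k)"
    using inv_fact_minus_one[of "int n + 1 - int k"] by (simp add: algebra_simps)
  have d: "inv_fact (2 * int k - int n - 1) = (2 * real k - real n) * inv_fact (2 * int k - int n)"
    using inv_fact_minus_one[of "2 * int k - int n"] by (simp add: algebra_simps)
  have e: "inv_fact (2 * int k - int n - 2) = (2 * real k - real n - 1) * inv_fact (2 * int k - int n - 1)"
    using inv_fact_minus_one[of "2 * int k - int n - 1"] by (simp add: algebra_simps)
  have t1: "term_root n k = c * (real n + 2 - real k) * (real n + 1 - real k)"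
    unfolding term_root_eq c_def b a by (simp add: mult_ac)
  have i1: "int (n + 1) - int k = int n + 1 - int k" "2 * int k - int (n + 1) = 2 * int k - int n - 1"
    by auto
  have t2: "term_root (n + 1) k = c * (real n + 2 - real k) * (2 * real k - real n)"
    unfolding term_root_eq c_def i1 a d by (simp add: mult_ac)
  have i2: "int (n + 2) - int k = int n + 2 - int k" "2 * int k - int (n + 2) = 2 * int k - int n - 2"
    by auto
  have t3: "term_root (n + 2) k = c * (2 * real k - real n) * (2 * real k - real n - 1)"
    unfolding term_root_eq c_def i2 e d by (simp add: mult_ac)
  have i3: "int (n + 2) - int (k + 1) = int n + 1 - int k" "2 * int (k + 1) - int (n + 2) = 2 * int k - int n"
    by auto
  have f2: "(fact (2 * (k + 1)) :: real) = 2 * real (k + 1) * ((2 * real k + 1) * fact (2 * k))"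
    using fact_Suc[of "Suc (2 * k)", where ?'a = real] by (simp add: algebra_simps)
  have f1: "(fact (k + 1) :: real) = real (k + 1) * fact k"
    by (simp add: algebra_simps)
  have "2 * x * (y * F) / (x * G) = 2 * y * (F / G)" if "x \<noteq> 0" for x y F G :: real
    using that by simp
  then have f: "(fact (2 * (k + 1)) :: real) / fact (k + 1) = 2 * (2 * real k + 1) * (fact (2 * k) / fact k)"
    unfolding f1 f2 by (metis of_nat_eq_0_iff Suc_eq_plus1 nat.distinct(1))
  have t4: "term_root (n + 2) (k + 1) = 2 * c * (2 * real k + 1) * (real n + 2 - real k)"
    unfolding term_root_eq c_def i3 f a by (simp add: mult_ac)
  show thesis by (rule that[OF t1 t2 t3 t4])
qed

text \<open>Creative telescoping: the recurrence operator applied to the \<open>k\<close>-th summand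
  is a difference \<open>H k - H (k + 1)\<close>.\<close>

lemma apery_rec_s_seq: "apery_rec (\<lambda>n. real (s_seq n))"
  unfolding apery_rec_def
proof
  fix n
  let ?p = "(2 * real n + 3) * (12 * (real n + 1)^2 + 12 * (real n + 1) + 4)"
    and ?q = "16 * (real n + 1)^3" and ?l = "(real n + 2)^3"
  \<comment> \<open>\<open>H k\<close> corresponds to \<open>kernel n (t + 1) * certificate n (t + 1)\<close> below, at \<open>t = -k\<close>.\<close>
  define H where "H k = (term_root (n + 2) k)^2 * (?l - 4 * (2 * real n + 3) * (n + 2 - real k)^2)" for k
  have step: "?l * (term_root (n + 2) k)^2 - ?p * (term_root (n + 1) k)^2 + ?q * (term_root n k)^2
    = H k - H (k + 1)" for k
  proof -
    obtain c where c:
      "term_root n k = c * (real n + 2 - real k) * (real n + 1 - real k)"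
      "term_root (n + 1) k = c * (real n + 2 - real k) * (2 * real k - real n)"
      "term_root (n + 2) k = c * (2 * real k - real n) * (2 * real k - real n - 1)"
      "term_root (n + 2) (k + 1) = 2 * c * (2 * real k + 1) * (real n + 2 - real k)"
      by (rule term_root_common)
    have "real (k + 1) = real k + 1" "real (n + 2) = real n + 2" by simp_all
    then show ?thesis
      unfolding H_def c by algebra
  qed
  have "?l * real (s_seq (n + 2)) - ?p * real (s_seq (n + 1)) + ?q * real (s_seq n)
    = (\<Sum>k\<le>n+2. ?l * (term_root (n + 2) k)^2 - ?p * (term_root (n + 1) k)^2 + ?q * (term_root n k)^2)"
    by (simp only: s_seq_eq_sum[of _ "n + 2"] le_add1 order_refl add_le_mono one_le_numeral
        sum_distrib_left sum.distrib sum_subtractf)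
  also have "\<dots> = (\<Sum>k\<le>n+2. H k - H (Suc k))" by (simp only: step Suc_eq_plus1)
  also have "\<dots> = H 0 - H (Suc (n + 2))" by (rule sum_telescope)
  \<comment> \<open>Both ends vanish, since \<open>0 choose (n + 2)\<close> and
    \<open>(n + 2) choose (n + 3)\<close> are zero.\<close>
  also have "H 0 = 0" unfolding H_def term_root_def by simp
  also have "H (Suc (n + 2)) = 0"
    unfolding H_def term_root_def using binomial_eq_0[of "n + 2" "Suc (n + 2)"]
    by (simp del: binomial_Suc_Suc)
  finally show "?l * real (s_seq (n + 2)) = ?p * real (s_seq (n + 1)) - ?q * real (s_seq n)"
    by simp
qed

lemma s_seq_0_1: "s_seq 0 = 1" "s_seq 1 = 4"
  by (simp_all add: s_seq_def)

text \<open>Only the summand \<open>k = n\<close>, a squared central binomial coefficient, is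
  kept.\<close>

lemma s_seq_lower_bound:
  assumes "n > 0"
  shows "(4^n / (2 * real n))^2 \<le> real (s_seq n)"
proof -
  have "(2 * n choose n)^2 \<le> s_seq n"
    unfolding s_seq_def
    using member_le_sum[of n "{0..n}" "\<lambda>k. (n choose k)^2 * ((2 * k) choose n)^2"] by simp
  then have "real (2 * n choose n)^2 \<le> real (s_seq n)"
    by (metis of_nat_le_iff of_nat_power)
  moreover have "(4^n / (2 * real n))^2 \<le> real (2 * n choose n)^2"
    by (intro power_mono central_binomial_lower_bound assms) simp
  ultimately show ?thesis by linarith
qed

section \<open>Derivative and bounds of the kernel\<close>

lemma kernel_has_derivative:
  assumes "t > 0"
  shows "(kernel n has_real_derivative kernel' n t) (at t)"
proof (induction n)
  case 0
  have "((\<lambda>t. 1 / t^2) has_real_derivative - 2 / t^3) (at t)"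
    using assms by (auto intro!: derivative_eq_intros simp: power2_eq_square power3_eq_cube)
  then show ?case by simp
next
  case (Suc n)
  have "((\<lambda>t. (2 * t + n) / (t + n + 1)) has_real_derivative ((real n + 2) / (t + n + 1)^2)) (at t)"
    using assms by (auto intro!: derivative_eq_intros simp: power2_eq_square field_simps)
  from DERIV_power[OF this, of 2]
  have "((\<lambda>t. ((2 * t + n) / (t + n + 1))^2) has_real_derivative
      2 * ((2 * t + n) / (t + n + 1)) * ((real n + 2) / (t + n + 1)^2)) (at t)"
    by (rule DERIV_cong) (simp add: mult_ac
        del: times_divide_eq_left times_divide_eq_right divide_divide_eq_left)
  from DERIV_mult[OF Suc this] show ?case by (simp only: kernel.simps kernel'.simps) (simp add: add_ac mult_ac)
qed

text \<open>The ratio \<open>(2 * t + n) / (t + n + 1)\<close> lies between 0 and 2, so each step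
  costs a factor of at most 4.\<close>

lemma kernel_bounds:
  assumes "t > 0"
  shows "0 \<le> kernel n t" "kernel n t \<le> 4^n / t^2"
proof (induction n)
  case (Suc n)
  have r: "0 \<le> (2 * t + n) / (t + n + 1)" "(2 * t + n) / (t + n + 1) \<le> 2"
    using assms by (auto simp: divide_simps)
  { case 1 show ?case using Suc(1) r by simp }
  { case 2
    have "kernel n t * ((2 * t + n) / (t + n + 1))^2 \<le> 4^n / t^2 * 2^2"
      using Suc r by (intro mult_mono power_mono) auto
    then show ?case by (simp add: mult.commute) }
qed (use assms in auto)

text \<open>In the product rule the old derivative gains a factor 4 and the new summand adds at most
  \<open>8 * 4^n / t^3\<close>; the linear factor matches as
  \<open>4 * (2 * n + 2) + 8 = 4 * (2 * n + 4)\<close>.\<close>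

lemma kernel'_bound:
  assumes "t > 0"
  shows "\<bar>kernel' n t\<bar> \<le> (2 * real n + 2) * 4^n / t^3"
proof (induction n)
  case 0
  then show ?case using assms by simp
next
  case (Suc n)
  let ?r = "(2 * t + n) / (t + n + 1)"
  have r: "0 \<le> ?r" "?r \<le> 2" using assms by (auto simp: divide_simps)
  have "(real n + 2) / (t + n + 1) * (1 / (t + n + 1)) \<le> 2 * (1 / t)"
    using assms by (intro mult_mono) (auto simp: divide_simps)
  then have d: "(real n + 2) / (t + n + 1)^2 \<le> 2 / t"
    by (simp add: power2_eq_square)
  have "\<bar>kernel' n t\<bar> * ?r^2 \<le> (2 * real n + 2) * 4^n / t^3 * 2^2"
    using Suc r assms by (intro mult_mono power_mono) auto
  moreover have "kernel n t * (2 * ?r * ((real n + 2) / (t + n + 1)^2)) \<le> 4^n / t^2 * (2 * 2 * (2 / t))"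
    using kernel_bounds[OF assms, of n] r d assms by (intro mult_mono) auto
  moreover have "\<bar>kernel' (Suc n) t\<bar> \<le> \<bar>kernel' n t\<bar> * ?r^2 + kernel n t * (2 * ?r * ((real n + 2) / (t + n + 1)^2))"
    using kernel_bounds(1)[OF assms, of n] r assms
    by (simp only: kernel'.simps) (rule order.trans[OF abs_triangle_ineq], simp add: abs_mult add.commute)
  ultimately have "\<bar>kernel' (Suc n) t\<bar> \<le> (2 * real n + 2) * 4^n / t^3 * 2^2 + 4^n / t^2 * (2 * 2 * (2 / t))"
    by linarith
  also have "\<dots> = (2 * real (Suc n) + 2) * 4^Suc n / t^3"
    using assms by (simp add: field_simps power2_eq_square power3_eq_cube)
  finally show ?case .
qed

section \<open>Creative telescoping for the kernel\<close>

text \<open>Before squaring, the numerator trades \<open>2*t * (2*t + 1)\<close> for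
  \<open>(2*t + n) * (2*t + n + 1)\<close> and the denominator trades \<open>t\<close> for
  \<open>t + n + 1\<close>.\<close>

lemma kernel_shift:
  assumes "t > 0"
  shows "kernel n (t + 1) = kernel n t * ((2*t + n) * (2*t + n + 1) / (2 * (2*t + 1) * (t + n + 1)))^2"
proof (induction n)
  case 0
  have "t \<noteq> 0" "t + 1 \<noteq> 0" "2 * t + 1 \<noteq> 0" using assms by auto
  then show ?case by (simp add: divide_simps) (simp add: algebra_simps power2_eq_square)
next
  case (Suc n)
  have frac: "a * b / (u * p) * (c / q) = a / p * (b * c / (u * q))" for a b c u p q :: real
    by (simp add: mult_ac)
  have cross: "(2*t + n) * (2*t + n + 1) / (2 * (2*t + 1) * (t + n + 1)) * ((2 * t + n + 2) / (t + n + 2))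
     = (2*t + n) / (t + n + 1) * ((2*t + n + 1) * (2*t + n + 2) / (2 * (2*t + 1) * (t + n + 2)))"
    by (rule frac)
  have sq: "r * a^2 * b^2 = r * c^2 * d^2" if "a * b = c * d" for r a b c d :: real
    using that by (metis mult.assoc power_mult_distrib)
  have e: "2 * (t + 1) + n = 2*t + n + 2" "t + 1 + n + 1 = t + n + 2" "t + Suc n + 1 = t + n + 2"
    "2*t + Suc n = 2*t + n + 1" "2*t + n + 1 + 1 = 2*t + n + 2"
    by simp_all
  show ?case
    by (simp only: kernel.simps Suc e) (rule sq[OF cross])
qed

text \<open>The factor \<open>(2*t - 1)^2\<close> turns under the shift into
  \<open>(2*t + 1)^2\<close>, which cancels the denominator in \<open>kernel_shift\<close>; it also
  gives the double zero at \<open>t = 1/2\<close>.\<close>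

definition certificate :: "nat \<Rightarrow> real \<Rightarrow> real" where
  "certificate n t = (2*t - 1)^2 * (4 * (real n + 2)^3 / (t + n + 1)^2 - 16 * (2 * real n + 3))"

lemma kernel_telescoping:
  assumes "t > 0"
  shows "(real n + 2)^3 * kernel (n + 2) t
     - (2 * real n + 3) * (12 * (real n + 1)^2 + 12 * (real n + 1) + 4) * kernel (n + 1) t
     + 16 * (real n + 1)^3 * kernel n t
   = kernel n (t + 1) * certificate n (t + 1) - kernel n t * certificate n t"
proof -
  define x where "x = real n"
  define d where "d = (t + x + 1)^2 * (t + x + 2)^2"
  have nz: "t + x + 1 \<noteq> 0" "t + x + 2 \<noteq> 0" "2*t + 1 \<noteq> 0" using assms unfolding x_def by auto
  then have d: "d \<noteq> 0" unfolding d_def by simp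
  let ?p = "(2 * x + 3) * (12 * (x + 1)^2 + 12 * (x + 1) + 4)"
  \<comment> \<open>\<open>y\<close> plays the role of \<open>c^2\<close> in
    \<open>term_root_common\<close>, with \<open>t\<close> for \<open>-k\<close>: every term becomes
    a polynomial multiple of \<open>y\<close>, which leaves a polynomial identity.\<close>
  define y where "y = kernel n t / d"
  have y0: "kernel n t = y * ((t + x + 1)^2 * (t + x + 2)^2)"
    using d unfolding y_def d_def by simp
  have y1: "kernel (n + 1) t = y * (2*t + x)^2 * (t + x + 2)^2"
    using nz y0 by (simp add: x_def[symmetric] power_divide)
  have "kernel (n + 2) t = kernel (n + 1) t * ((2*t + x + 1) / (t + x + 2))^2"
    by (simp add: x_def add_ac numeral_2_eq_2)
  then have y2: "kernel (n + 2) t = y * (2*t + x)^2 * (2*t + x + 1)^2"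
    using nz unfolding y1 by (simp add: power_divide)
  have "kernel n (t + 1) * (2*t + 1)^2 / (t + x + 2)^2 = y * (2*t + x)^2 * (2*t + x + 1)^2 / 4"
  proof -
    have "y * (p^2 * q^2) * (a * b / (2 * w * p))^2 * w^2 / q^2 = y * a^2 * b^2 / 4"
      if "p \<noteq> 0" "q \<noteq> 0" "w \<noteq> 0" for p q w a b
      using that by (simp add: power_divide power_mult_distrib)
    from this[OF nz] show ?thesis
      unfolding kernel_shift[OF assms] x_def[symmetric] y0 .
  qed
  moreover have "certificate n (t + 1) = (2*t + 1)^2 / (t + x + 2)^2 * (4 * (x + 2)^3 - 16 * (2*x + 3) * (t + x + 2)^2)"
    unfolding certificate_def x_def[symmetric] using nz by (simp add: field_simps)
  ultimately have a: "kernel n (t + 1) * certificate n (t + 1)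
     = y * (2*t + x)^2 * (2*t + x + 1)^2 * ((x + 2)^3 - 4 * (2*x + 3) * (t + x + 2)^2)"
    by algebra
  have "certificate n t * (t + x + 1)^2 = (2*t - 1)^2 * (4 * (x + 2)^3 - 16 * (2*x + 3) * (t + x + 1)^2)"
    unfolding certificate_def x_def[symmetric] using nz by (simp add: field_simps)
  then have b: "kernel n t * certificate n t
     = y * (t + x + 2)^2 * (2*t - 1)^2 * (4 * (x + 2)^3 - 16 * (2*x + 3) * (t + x + 1)^2)"
    unfolding y0 by algebra
  show ?thesis
    unfolding a b unfolding x_def[symmetric] y0 y1 y2 by algebra
qed

section \<open>The series over half-integers\<close>

definition remainder :: "nat \<Rightarrow> real" where
  "remainder n = (\<Sum>m. - kernel' n (real m + 1 / 2))"

lemma summable_half_integer_cubes: "summable (\<lambda>m. 1 / (real m + 1 / 2)^3)"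
proof (rule summable_comparison_test_ev)
  show "\<forall>\<^sub>F m in sequentially. norm (1 / (real m + 1 / 2)^3) \<le> 1 / real m ^ 3"
    \<comment> \<open>At \<open>m = 0\<close> the right-hand side is 0 by the convention for
      division, so the comparison starts at \<open>m = 1\<close>.\<close>
    using eventually_gt_at_top[of 0]
    by eventually_elim (auto intro!: divide_left_mono power_mono simp: abs_of_pos)
  show "summable (\<lambda>m. 1 / real m ^ 3)"
    using inverse_power_summable[of 3, where ?'a = real] by (simp add: inverse_eq_divide)
qed

lemma kernel'_norm_bound:
  "norm (- kernel' n (real m + 1 / 2)) \<le> (2 * real n + 2) * 4^n * (1 / (real m + 1 / 2)^3)"
  using kernel'_bound[of "real m + 1 / 2" n] by simp

lemma summable_R': "summable (\<lambda>m. - kernel' n (real m + 1 / 2))"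
  by (rule summable_comparison_test'[OF summable_mult[OF summable_half_integer_cubes]])
     (rule kernel'_norm_bound)

lemma remainder_bound:
  "\<bar>remainder n\<bar> \<le> (2 * real n + 2) * 4^n * (\<Sum>m. 1 / (real m + 1 / 2)^3)"
proof -
  have "norm (remainder n) \<le> (\<Sum>m. (2 * real n + 2) * 4^n * (1 / (real m + 1 / 2)^3))"
    unfolding remainder_def
    by (rule norm_suminf_le[OF kernel'_norm_bound]) (intro summable_mult summable_half_integer_cubes)
  then show ?thesis by (simp only: suminf_mult[OF summable_half_integer_cubes] real_norm_def)
qed

section \<open>The recurrence for the remainder\<close>

definition certificate' :: "nat \<Rightarrow> real \<Rightarrow> real" where
  "certificate' n t = 4 * (2*t - 1) * (4 * (real n + 2)^3 / (t + n + 1)^2 - 16 * (2 * real n + 3))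
     - (2*t - 1)^2 * (8 * (real n + 2)^3 / (t + n + 1)^3)"

lemma certificate_has_derivative:
  assumes "t > 0"
  shows "(certificate n has_real_derivative certificate' n t) (at t)"
proof -
  have "((\<lambda>u. a / u^2 - b) has_real_derivative - (2 * a / u^3)) (at u)" if "u \<noteq> 0" for a b u
    using that by (auto intro!: derivative_eq_intros simp: power2_eq_square power3_eq_cube mult_ac)
  from this[of "t + (real n + 1)" "4 * (real n + 2)^3" "16 * (2 * real n + 3)"]
  have "((\<lambda>t. 4 * (real n + 2)^3 / (t + n + 1)^2 - 16 * (2 * real n + 3)) has_real_derivative
     - (8 * (real n + 2)^3 / (t + n + 1)^3)) (at t)"
    using assms unfolding DERIV_shift by (simp add: add.assoc)
  moreover have "((\<lambda>t. (2*t - 1)^2) has_real_derivative 4 * (2*t - 1)) (at t)"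
    by (auto intro!: derivative_eq_intros)
  ultimately show ?thesis
    unfolding certificate_def[abs_def] certificate'_def
  proof (rule DERIV_cong[OF DERIV_mult[rotated]])
    show "p * x + - y * q = p * x - q * y" for p x y q :: real
      by simp
  qed
qed

definition boundary' :: "nat \<Rightarrow> real \<Rightarrow> real" where
  "boundary' n t = kernel' n t * certificate n t + kernel n t * certificate' n t"

lemma boundary_has_derivative:
  assumes "t > 0"
  shows "((\<lambda>t. kernel n t * certificate n t) has_real_derivative boundary' n t) (at t)"
  using DERIV_mult[OF kernel_has_derivative certificate_has_derivative, OF assms assms]
  unfolding boundary'_def by (rule DERIV_cong) simp

text \<open>Differentiation of \<open>kernel_telescoping\<close> in \<open>t\<close>.\<close>

lemma kernel'_telescoping:
  assumes "t > 0"
  shows "(real n + 2)^3 * kernel' (n + 2) t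
     - (2 * real n + 3) * (12 * (real n + 1)^2 + 12 * (real n + 1) + 4) * kernel' (n + 1) t
     + 16 * (real n + 1)^3 * kernel' n t
   = boundary' n (t + 1) - boundary' n t"
proof (rule DERIV_unique)
  let ?p = "(2 * real n + 3) * (12 * (real n + 1)^2 + 12 * (real n + 1) + 4)"
  show "((\<lambda>t. (real n + 2)^3 * kernel (n + 2) t - ?p * kernel (n + 1) t + 16 * (real n + 1)^3 * kernel n t)
    has_real_derivative (real n + 2)^3 * kernel' (n + 2) t - ?p * kernel' (n + 1) t + 16 * (real n + 1)^3 * kernel' n t) (at t)"
    by (intro DERIV_add DERIV_diff DERIV_cmult kernel_has_derivative assms)
  have "((\<lambda>t. kernel n (t + 1) * certificate n (t + 1)) has_real_derivative boundary' n (t + 1)) (at t)"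
    using boundary_has_derivative[of "t + 1" n] assms
    by (simp only: DERIV_shift)
  then have deriv: "((\<lambda>t. kernel n (t + 1) * certificate n (t + 1) - kernel n t * certificate n t)
    has_real_derivative boundary' n (t + 1) - boundary' n t) (at t)"
    by (rule DERIV_diff[OF _ boundary_has_derivative[OF assms]])
  \<comment> \<open>The undifferentiated identity is available for positive arguments only, hence on
    a neighbourhood of \<open>t\<close>.\<close>
  have ev: "\<forall>\<^sub>F t in nhds t. kernel n (t + 1) * certificate n (t + 1) - kernel n t * certificate n t
    = (real n + 2)^3 * kernel (n + 2) t - ?p * kernel (n + 1) t + 16 * (real n + 1)^3 * kernel n t"
  proof -
    have "\<forall>\<^sub>F x in nhds t. x \<in> {0<..}"
      by (rule eventually_nhds_in_open) (use assms in auto)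
    then show ?thesis
    proof eventually_elim
      case (elim x)
      then show ?case using kernel_telescoping[of x n] by simp
    qed
  qed
  show "((\<lambda>t. (real n + 2)^3 * kernel (n + 2) t - ?p * kernel (n + 1) t + 16 * (real n + 1)^3 * kernel n t)
    has_real_derivative boundary' n (t + 1) - boundary' n t) (at t)"
    by (rule iffD1[OF DERIV_cong_ev[OF refl ev refl] deriv])
qed

text \<open>\<open>certificate\<close> has a double zero at \<open>1/2\<close>, so its derivative
  vanishes there too.\<close>

lemma boundary'_half: "boundary' n (1 / 2) = 0"
  by (simp add: boundary'_def certificate_def certificate'_def)

text \<open>\<open>kernel'\<close> decays like \<open>t^(-3)\<close> against quadratic growth of
  \<open>certificate\<close>, and \<open>kernel\<close> like \<open>t^(-2)\<close> against linear
  growth of \<open>certificate'\<close>.\<close>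

lemma boundary'_tendsto_0: "(\<lambda>m. boundary' n (real m + 1 / 2)) \<longlonglongrightarrow> 0"
proof -
  let ?x = "\<lambda>m. real m + 1 / 2"
  define c where "c = real n"
  define A where "A = 4 * (c + 2)^3"
  define B where "B = 16 * (2 * c + 3)"
  define K where "K = (2 * c + 2) * 4^n"
  define q where "q = (\<lambda>k m. 1 / (?x m + c + 1)^k)"
  have q: "q 2 \<longlonglongrightarrow> 0" "q 3 \<longlonglongrightarrow> 0" unfolding q_def by real_asymp+
  \<comment> \<open>At \<open>t = m + 1/2\<close> the factor \<open>2*t - 1\<close> equals
    \<open>2*m\<close>.\<close>
  have certificate: "certificate n (?x m) = 4 * (real m)^2 * (A * q 2 m - B)"
    and certificate': "certificate' n (?x m) = 8 * real m * (A * q 2 m - B) - 4 * (real m)^2 * (2 * A * q 3 m)"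
    for m
    by (simp_all add: certificate_def certificate'_def A_def B_def q_def c_def power_mult_distrib)
  have lim: "(\<lambda>m. 4 * (real m)^2 / (?x m)^3) \<longlonglongrightarrow> 0" "(\<lambda>m. 8 * real m / (?x m)^2) \<longlonglongrightarrow> 0"
    "(\<lambda>m. 4 * (real m)^2 / (?x m)^2) \<longlonglongrightarrow> 4"
    by real_asymp+
  have "(\<lambda>m. kernel' n (?x m) * certificate n (?x m)) \<longlonglongrightarrow> 0"
  proof (rule Lim_null_comparison)
    show "\<forall>\<^sub>F m in sequentially. norm (kernel' n (?x m) * certificate n (?x m))
      \<le> \<bar>K * (4 * (real m)^2 / (?x m)^3) * (A * q 2 m - B)\<bar>"
    proof (intro always_eventually allI)
      fix m
      have "\<bar>kernel' n (?x m)\<bar> * \<bar>certificate n (?x m)\<bar> \<le> K / (?x m)^3 * \<bar>certificate n (?x m)\<bar>"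
        unfolding K_def c_def by (intro mult_right_mono kernel'_bound) auto
      then show "norm (kernel' n (?x m) * certificate n (?x m))
        \<le> \<bar>K * (4 * (real m)^2 / (?x m)^3) * (A * q 2 m - B)\<bar>"
        by (simp add: certificate abs_mult K_def c_def mult_ac)
    qed
    have "(\<lambda>m. K * (4 * (real m)^2 / (?x m)^3) * (A * q 2 m - B)) \<longlonglongrightarrow> K * 0 * (A * 0 - B)"
      by (intro tendsto_intros lim q)
    then show "(\<lambda>m. \<bar>K * (4 * (real m)^2 / (?x m)^3) * (A * q 2 m - B)\<bar>) \<longlonglongrightarrow> 0"
      by (intro tendsto_rabs_zero) simp
  qed
  moreover have "(\<lambda>m. kernel n (?x m) * certificate' n (?x m)) \<longlonglongrightarrow> 0"
  proof (rule Lim_null_comparison)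
    let ?g = "\<lambda>m. 4^n * (8 * real m / (?x m)^2 * (A * q 2 m - B) - 4 * (real m)^2 / (?x m)^2 * (2 * A * q 3 m))"
    show "\<forall>\<^sub>F m in sequentially. norm (kernel n (?x m) * certificate' n (?x m)) \<le> \<bar>?g m\<bar>"
    proof (intro always_eventually allI)
      fix m
      have "kernel n (?x m) * \<bar>certificate' n (?x m)\<bar> \<le> 4^n / (?x m)^2 * \<bar>certificate' n (?x m)\<bar>"
        by (intro mult_right_mono kernel_bounds) auto
      also have "\<dots> = \<bar>4^n / (?x m)^2 * certificate' n (?x m)\<bar>"
        by (simp add: abs_mult)
      also have "4^n / (?x m)^2 * certificate' n (?x m) = ?g m"
        unfolding certificate' by (simp add: right_diff_distrib diff_divide_distrib mult_ac)
      finally show "norm (kernel n (?x m) * certificate' n (?x m)) \<le> \<bar>?g m\<bar>"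
        by (simp add: abs_mult kernel_bounds)
    qed
    have "?g \<longlonglongrightarrow> 4^n * (0 * (A * 0 - B) - 4 * (2 * A * 0))"
      by (intro tendsto_intros lim q)
    then show "(\<lambda>m. \<bar>?g m\<bar>) \<longlonglongrightarrow> 0"
      by (intro tendsto_rabs_zero) simp
  qed
  ultimately have "(\<lambda>m. kernel' n (?x m) * certificate n (?x m) + kernel n (?x m) * certificate' n (?x m)) \<longlonglongrightarrow> 0 + 0"
    by (rule tendsto_add)
  then show ?thesis unfolding boundary'_def by simp
qed

text \<open>Summing \<open>kernel'_telescoping\<close> over \<open>m\<close> leaves
  \<open>boundary'\<close> at \<open>1/2\<close> and its limit at infinity, both zero.\<close>

lemma apery_rec_remainder: "apery_rec remainder"
  unfolding apery_rec_def
proof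
  fix n
  let ?p = "(2 * real n + 3) * (12 * (real n + 1)^2 + 12 * (real n + 1) + 4)"
    and ?q = "16 * (real n + 1)^3" and ?l = "(real n + 2)^3"
  have sums: "(\<lambda>m. - kernel' k (real m + 1 / 2)) sums remainder k" for k
    unfolding remainder_def by (rule summable_sums[OF summable_R'])
  let ?b = "\<lambda>m. boundary' n (real m + 1 / 2)"
  have "(\<lambda>m. ?l * (- kernel' (n + 2) (real m + 1 / 2)) - ?p * (- kernel' (n + 1) (real m + 1 / 2))
      + ?q * (- kernel' n (real m + 1 / 2)))
    sums (?l * remainder (n + 2) - ?p * remainder (n + 1) + ?q * remainder n)"
    by (intro sums_add sums_diff sums_mult sums)
  moreover have "?l * (- kernel' (n + 2) (real m + 1 / 2)) - ?p * (- kernel' (n + 1) (real m + 1 / 2))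
      + ?q * (- kernel' n (real m + 1 / 2)) = ?b m - ?b (Suc m)" for m
  proof -
    have e: "real (Suc m) + 1 / 2 = (real m + 1 / 2) + 1" by simp
    have "?l * kernel' (n + 2) (real m + 1 / 2) - ?p * kernel' (n + 1) (real m + 1 / 2)
      + ?q * kernel' n (real m + 1 / 2) = ?b (Suc m) - ?b m"
      unfolding e by (rule kernel'_telescoping) simp
    then show ?thesis by algebra
  qed
  moreover have "(\<lambda>m. ?b m - ?b (Suc m)) sums (?b 0 - 0)"
    by (rule telescope_sums'[OF boundary'_tendsto_0])
  ultimately have "?l * remainder (n + 2) - ?p * remainder (n + 1) + ?q * remainder n = ?b 0 - 0"
    using sums_unique2 by simp
  then show "?l * remainder (n + 2) = ?p * remainder (n + 1) - ?q * remainder n"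
    by (simp add: boundary'_half)
qed

section \<open>Initial values and the value of zeta at 3\<close>

lemma remainder_0: "remainder 0 = 2 * (\<Sum>m. 1 / (real m + 1 / 2)^3)"
proof -
  have "remainder 0 = (\<Sum>m. 2 * (1 / (real m + 1 / 2)^3))"
    unfolding remainder_def by simp
  then show ?thesis by (simp only: suminf_mult[OF summable_half_integer_cubes])
qed

text \<open>\<open>kernel 1 t\<close> is \<open>4 / (t + 1)^2\<close> for \<open>t > 0\<close>, so
  the series is shifted by one place; the lost first term is \<open>8 * 8 = 64\<close>.\<close>

lemma remainder_1: "remainder 1 = 8 * (\<Sum>m. 1 / (real m + 1 / 2)^3) - 64"
proof -
  have "- kernel' 1 t = 8 * (1 / (t + 1)^3)" if "t > 0" for t
  proof -
    have "- (- 2 / t^3 * (2 * t / u)^2 + 1 / t^2 * (2 * (2 * t / u) * (2 / u^2))) = 8 * (u - 1) / (t * u^3)"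
      if "u \<noteq> 0" for u
      using that \<open>t > 0\<close> by (simp add: field_simps power2_eq_square power3_eq_cube)
    from this[of "t + 1"] show ?thesis using that by simp
  qed
  from this[of "real m + 1 / 2" for m]
  have "remainder 1 = (\<Sum>m. 8 * (1 / (real (Suc m) + 1 / 2)^3))"
    unfolding remainder_def by (simp add: add_ac)
  also have "\<dots> = 8 * (\<Sum>m. 1 / (real (Suc m) + 1 / 2)^3)"
    by (rule suminf_mult[OF iffD2[OF summable_Suc_iff summable_half_integer_cubes]])
  also have "\<dots> = 8 * ((\<Sum>m. 1 / (real m + 1 / 2)^3) - 8)"
    using suminf_split_head[OF summable_half_integer_cubes] by (simp add: power3_eq_cube)
  finally show ?thesis by simp
qed

text \<open>The odd denominators contribute one eighth of the half-integer sum and the even ones one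
  eighth of zeta(3) itself; solving for zeta(3) gives the factor 1/7.\<close>

lemma riemann_zeta_3: "riemann_zeta 3 = of_real (1 / 7 * (\<Sum>m. 1 / (real m + 1 / 2)^3))"
proof -
  let ?z = "\<lambda>n. 1 / real (Suc n) ^ 3"
  have summable: "summable ?z"
    using inverse_power_summable[of 3, where ?'a = real] summable_Suc_iff[of "\<lambda>n. 1 / real n ^ 3"]
    by (simp add: inverse_eq_divide)
  have "1 / (of_nat (Suc n) :: complex) powr 3 = of_real (?z n)" for n
    by simp
  then have "riemann_zeta 3 = (\<Sum>n. of_real (?z n))"
    unfolding riemann_zeta_def dirichlet_zeta_def by simp
  also have "\<dots> = of_real (\<Sum>n. ?z n)"
    by (rule suminf_of_real[OF summable, symmetric])
  also have "(\<Sum>n. ?z n) = 1 / 7 * (\<Sum>m. 1 / (real m + 1 / 2)^3)"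
  proof -
    have "(\<lambda>m. \<Sum>n\<in>{m*2..<m*2+2}. ?z n) sums (\<Sum>n. ?z n)"
      by (rule sums_group[OF summable_sums[OF summable]]) simp
    moreover have "(\<Sum>n\<in>{m*2..<m*2+2}. ?z n) = 1 / 8 * (1 / (real m + 1 / 2)^3) + 1 / 8 * ?z m" for m
    proof -
      have "{m*2..<m*2+2} = {2*m, Suc (2*m)}" by auto
      then have "(\<Sum>n\<in>{m*2..<m*2+2}. ?z n) = 1 / real (Suc (2*m)) ^ 3 + 1 / real (Suc (Suc (2*m))) ^ 3"
        by simp
      also have "real (Suc (2*m)) = 2 * (real m + 1 / 2)" by simp
      also have "real (Suc (Suc (2*m))) = 2 * real (Suc m)" by simp
      also have "1 / (2 * x)^3 + 1 / (2 * y)^3 = 1 / 8 * (1 / x^3) + 1 / 8 * (1 / y^3)" for x y :: real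
        by (simp add: power_mult_distrib)
      finally show ?thesis .
    qed
    ultimately have "(\<lambda>m. 1 / 8 * (1 / (real m + 1 / 2)^3) + 1 / 8 * ?z m) sums (\<Sum>n. ?z n)"
      by (simp only:)
    moreover have "(\<lambda>m. 1 / 8 * (1 / (real m + 1 / 2)^3) + 1 / 8 * ?z m)
       sums (1 / 8 * (\<Sum>m. 1 / (real m + 1 / 2)^3) + 1 / 8 * (\<Sum>n. ?z n))"
      by (intro sums_add sums_mult summable_sums summable summable_half_integer_cubes)
    ultimately have "(\<Sum>n. ?z n) = 1 / 8 * (\<Sum>m. 1 / (real m + 1 / 2)^3) + 1 / 8 * (\<Sum>n. ?z n)"
      by (rule sums_unique2)
    then show ?thesis by linarith
  qed
  finally show ?thesis .
qed

section \<open>Passage to the limit\<close>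

lemma remainder_div_s_seq_tendsto_0: "(\<lambda>n. remainder n / real (s_seq n)) \<longlonglongrightarrow> 0"
proof (rule Lim_null_comparison)
  define L where "L = (\<Sum>m. 1 / (real m + 1 / 2)^3)"
  have "L \<ge> 0" unfolding L_def by (rule suminf_nonneg[OF summable_half_integer_cubes]) simp
  show "\<forall>\<^sub>F n in sequentially. norm (remainder n / real (s_seq n))
    \<le> (2 * real n + 2) * 4^n * L / (4^n / (2 * real n))^2"
    using eventually_gt_at_top[of 0]
  proof eventually_elim
    case (elim n)
    have "\<bar>remainder n\<bar> / real (s_seq n) \<le> (2 * real n + 2) * 4^n * L / (4^n / (2 * real n))^2"
      using s_seq_lower_bound[OF elim] remainder_bound[of n] \<open>L \<ge> 0\<close> elim
      by (intro frac_le) (auto simp: L_def)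
    then show ?case by simp
  qed
  show "(\<lambda>n. (2 * real n + 2) * 4^n * L / (4^n / (2 * real n))^2) \<longlonglongrightarrow> 0"
    by real_asymp
qed

theorem theorem1p1:
  fixes B :: "nat \<Rightarrow> rat"
  assumes "B 0 = 0"
    and "B 1 = 1"
    and "\<And>n. n \<ge> 1 \<Longrightarrow>
      (of_nat n + 1)^3 * B (n + 1) =
        (2 * of_nat n + 1) * (12 * (of_nat n)^2 + 12 * of_nat n + 4) * B n
        - 16 * (of_nat n)^3 * B (n - 1)"
  shows "(\<lambda>n. of_rat (B n) / of_nat (s_seq n)) \<longlonglongrightarrow> 7 / 32 * riemann_zeta 3"
proof -
  define b where "b n = (of_rat (B n) :: real)" for n
  define L where "L = (\<Sum>m. 1 / (real m + 1 / 2)^3)"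
  have "apery_rec b"
    unfolding apery_rec_def
  proof
    fix n
    have "(of_nat (n + 1) + 1)^3 * B (n + 1 + 1) =
        (2 * of_nat (n + 1) + 1) * (12 * (of_nat (n + 1))^2 + 12 * of_nat (n + 1) + 4) * B (n + 1)
        - 16 * (of_nat (n + 1))^3 * B n"
      using assms(3)[of "n + 1"] by simp
    from arg_cong[OF this, of "of_rat :: rat \<Rightarrow> real"]
    have "(real (n + 1) + 1)^3 * b (n + 1 + 1) =
        (2 * real (n + 1) + 1) * (12 * (real (n + 1))^2 + 12 * real (n + 1) + 4) * b (n + 1)
        - 16 * (real (n + 1))^3 * b n"
      unfolding b_def by (simp only: of_rat_add of_rat_diff of_rat_mult of_rat_power of_rat_of_nat_eq
          of_rat_numeral_eq of_rat_1)
    then show "(real n + 2)^3 * b (n + 2)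
     = (2 * real n + 3) * (12 * (real n + 1)^2 + 12 * (real n + 1) + 4) * b (n + 1)
       - 16 * (real n + 1)^3 * b n"
      by (simp add: add_ac)
  qed
  \<comment> \<open>The coefficients are fitted to the initial values: \<open>2 * L\<close> at
    \<open>n = 0\<close>, where \<open>b\<close> is 0, and \<open>8 * L - 64\<close> at
    \<open>n = 1\<close>, where \<open>s_seq\<close> is 4 and \<open>b\<close> is 1.\<close>
  then have "apery_rec (\<lambda>n. 2 * L * real (s_seq n) + (- 64) * b n)"
    by (rule apery_rec_lincomb[OF apery_rec_s_seq])
  then have rem: "remainder n = 2 * L * real (s_seq n) + (- 64) * b n" for n
    by (rule apery_rec_unique[OF apery_rec_remainder])
       (use assms(1,2) in \<open>simp_all add: remainder_0 remainder_1 s_seq_0_1 b_def L_def flip: One_nat_def\<close>)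
  have pos: "s_seq n \<noteq> 0" for n
  proof (cases "n = 0")
    case False
    then have "0 < (4^n / (2 * real n))^2" by simp
    also have "\<dots> \<le> real (s_seq n)" using s_seq_lower_bound False by blast
    finally show ?thesis by simp
  qed (simp add: s_seq_0_1)
  have "b n / real (s_seq n) = 1 / 32 * L - 1 / 64 * (remainder n / real (s_seq n))" for n
    using pos[of n] by (simp add: rem[of n] field_simps)
  moreover have "(\<lambda>n. 1 / 32 * L - 1 / 64 * (remainder n / real (s_seq n))) \<longlonglongrightarrow> 1 / 32 * L - 1 / 64 * 0"
    by (intro tendsto_intros remainder_div_s_seq_tendsto_0)
  ultimately have "(\<lambda>n. b n / real (s_seq n)) \<longlonglongrightarrow> 1 / 32 * L" by simp
  then have "(\<lambda>n. of_real (b n / real (s_seq n)) :: complex) \<longlonglongrightarrow> of_real (1 / 32 * L)"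
    by (rule tendsto_of_real)
  \<comment> \<open>Writing \<open>B n\<close> as a fraction of integers identifies its complex
    image with that of the real \<open>b n\<close>.\<close>
  moreover have "(of_real (b n / real (s_seq n)) :: complex) = of_rat (B n) / of_nat (s_seq n)" for n
    by (cases "B n") (simp add: b_def of_rat_rat)
  ultimately have "(\<lambda>n. of_rat (B n) / of_nat (s_seq n) :: complex) \<longlonglongrightarrow> of_real (1 / 32 * L)"
    by (simp only:)
  then show ?thesis
    by (simp add: riemann_zeta_3 L_def)
qed

end
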